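(* Let $N\ge1$, let $\omega_0,\dots,\omega_{N-1}>0$ be constant Lagrangian markers, and let $\bar v>0$ with $\bar v\le\min_{i=0,\dots,N-1}\omega_i$. Consider the nonlocal microscopic traffic model described in the context with gaps $y_i(t)=x_{i+1}(t)-x_i(t)$, and let $\bar L_i>0$ be the equilibrium distances, i.e. $v\left(\frac{1}{N\bar L_i},\omega_i\right)=\bar v$, $i=0,\dots,N-1$. Assume that the kernel is constant, $w(x)=\frac1\eta$ on $[0,\eta]$, and that there is a constant $v'_{\max}<0$ with $\max_{i\in\{0,\dots,N-1\}}\partial_\rho v(\rho,\omega_i)\le v'_{\max}$ for all admissible densities $\rho$. Let the initial placement of cars and $\bar v$ be such that there exists an integer in $\{0,\dots,N-1\}$ satisfying $$\sum_{i=J}^{N-1}\max\{y_i(0),\bar L_i\}\le\eta ,$$ and let $J$ be the smallest such integer. Define $$L(t):=\sum_{i=J}^{N-1}y_i(t)\left(\frac{1}{Ny_i(t)}-\frac{1}{N\bar L_i}\right)^2,\qquad \rho_{\min}:=\min_{i=J,\dots,N-1}\min\left\{\frac{1}{Ny_i(0)},\frac{1}{N\bar L_i}\right\}.$$ Then $$L(t)\le L(0)\exp\left(\frac{2}{\eta}\,v'_{\max}\,\rho_{\min}\,t\right)\qquad\text{for all } t\ge0 .$$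
   Context: Kernel. Fix $\eta>0$ and a kernel $w:[0,\eta]\to[0,\infty)$ with $\int_0^\eta w(x)\,dx=1$ (here constant). Set $\tilde w(x)=w(x)$ for $x\in[0,\eta]$ and $\tilde w(x)=0$ otherwise. Velocity. $v(\rho,\omega)$ is twice continuously differentiable in $\rho$ and continuously differentiable in $\omega$. For every $\omega>0$ there is $\rho^{\max}_\omega>0$ with $v(\rho^{\max}_\omega,\omega)=0$; the admissible densities for $\omega$ are $\rho\in[0,\rho^{\max}_\omega]$. On admissible densities: $v(\rho,\omega)\ge 0$, $v(0,\omega)=\omega$, $v(\rho,0)=0$; $\frac{\partial^2}{\partial\rho^2}\big(\rho v(\rho,\omega)\big)<0$ for $\omega>0$; and $\frac{\partial v}{\partial\omega}(\rho,\omega)>0$ for $0\le\rho<\rho^{\max}_\omega$. Microscopic model. There are $N+1$ cars with positions $x_0(t)<x_1(t)<\dots<x_N(t)$, whose initial gaps correspond to admissible densities, i.e. $\frac{1}{Ny_i(0)}\le\rho^{\max}_{\omega_i}$, satisfying for $t>0$ $$\frac{d}{dt}x_i(t)=\sum_{j=0}^{N_\eta-1}\gamma_{i,j}(t)V_{i,j}(t),\quad i=0,\dots,N,$$ where $$V_{i,j}(t)=v\left(\frac{1}{N(x_{i+1+j}(t)-x_{i+j}(t))},\omega_{i+j}\right)\ \text{if } i+j\le N-1,\qquad V_{i,j}(t)=\bar v\ \text{if } i+j>N-1$$ (in particular $\frac{d}{dt}x_N=\bar v$), and the weights are $$\gamma_{i,j}(t)=\begin{cases}\int_{x_{i+j}(t)}^{x_{i+j+1}(t)}\tilde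 w(y-x_i(t))\,dy,& i+j\le N-1,\\ \int_{\min\{x_N(t),x_i(t)+\eta\}}^{x_i(t)+\eta}\tilde w(y-x_i(t))\,dy,& i+j=N,\\ 0,& i+j>N.\end{cases}$$ The integer $N_\eta$ is large enough that $x_{i+N_\eta}(t)-x_i(t)\ge\eta$ whenever $i+N_\eta\le N$ (so $\gamma_{i,j}=0$ for $j\ge N_\eta$ and $\sum_{j=0}^{N_\eta-1}\gamma_{i,j}(t)=1$). *)

theory Defs
  imports "HOL-Analysis.Analysis"
begin

section \<open>Regularity on the half-line\<close>

text \<open>Densities and markers range over \<open>{0..}\<close>; derivatives are taken within that set, hence
  one-sided at \<open>0\<close>. Where the derivative exists it is unique, also at \<open>0\<close>.\<close>

definition deriv_nn :: "(real \<Rightarrow> real) \<Rightarrow> real \<Rightarrow> real" where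
  "deriv_nn f x = vector_derivative f (at x within {0..})"

definition C1_nn :: "(real \<Rightarrow> real) \<Rightarrow> bool" where
  "C1_nn f \<longleftrightarrow> f differentiable_on {0..} \<and> continuous_on {0..} (deriv_nn f)"

definition C2_nn :: "(real \<Rightarrow> real) \<Rightarrow> bool" where
  "C2_nn f \<longleftrightarrow> C1_nn f \<and> C1_nn (deriv_nn f)"

section \<open>Velocity\<close>

definition partial_rho :: "(real \<Rightarrow> real \<Rightarrow> real) \<Rightarrow> real \<Rightarrow> real \<Rightarrow> real" where
  "partial_rho v \<rho> \<omega> = deriv_nn (\<lambda>r. v r \<omega>) \<rho>"

definition partial_omega :: "(real \<Rightarrow> real \<Rightarrow> real) \<Rightarrow> real \<Rightarrow> real \<Rightarrow> real" where
  "partial_omega v \<rho> \<omega> = deriv_nn (\<lambda>z. v \<rho> z) \<omega>"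

text \<open>The admissible densities for a marker \<open>\<omega> > 0\<close> are \<open>{0..rho_max \<omega>}\<close>. The regularity
  assumptions are separate in the two variables, not joint.\<close>

locale velocity_law =
  fixes v :: "real \<Rightarrow> real \<Rightarrow> real" and rho_max :: "real \<Rightarrow> real"
  assumes C2_in_rho: "\<And>\<omega>. 0 \<le> \<omega> \<Longrightarrow> C2_nn (\<lambda>\<rho>. v \<rho> \<omega>)"
    and C1_in_omega: "\<And>\<rho>. 0 \<le> \<rho> \<Longrightarrow> C1_nn (\<lambda>\<omega>. v \<rho> \<omega>)"
    and rho_max_pos: "\<And>\<omega>. 0 < \<omega> \<Longrightarrow> 0 < rho_max \<omega>"
    and v_rho_max: "\<And>\<omega>. 0 < \<omega> \<Longrightarrow> v (rho_max \<omega>) \<omega> = 0"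
    and v_nonneg: "\<And>\<omega> \<rho>. 0 < \<omega> \<Longrightarrow> \<rho> \<in> {0..rho_max \<omega>} \<Longrightarrow> 0 \<le> v \<rho> \<omega>"
    and v_zero_rho: "\<And>\<omega>. 0 < \<omega> \<Longrightarrow> v 0 \<omega> = \<omega>"
    and v_zero_omega: "\<And>\<omega> \<rho>. 0 < \<omega> \<Longrightarrow> \<rho> \<in> {0..rho_max \<omega>} \<Longrightarrow> v \<rho> 0 = 0"
    and flux_concave: "\<And>\<omega> \<rho>. 0 < \<omega> \<Longrightarrow> \<rho> \<in> {0..rho_max \<omega>} \<Longrightarrow>
          deriv_nn (deriv_nn (\<lambda>r. r * v r \<omega>)) \<rho> < 0"
    and v_incr_omega: "\<And>\<omega> \<rho>. 0 < \<omega> \<Longrightarrow> 0 \<le> \<rho> \<Longrightarrow> \<rho> < rho_max \<omega> \<Longrightarrow>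
          0 < partial_omega v \<rho> \<omega>"

section \<open>Kernel\<close>

locale nonlocal_kernel =
  fixes \<eta> :: real and w :: "real \<Rightarrow> real"
  assumes eta_pos: "0 < \<eta>"
    and w_nonneg: "\<And>s. s \<in> {0..\<eta>} \<Longrightarrow> 0 \<le> w s"
    and w_integral: "(w has_integral 1) {0..\<eta>}"

definition kernel_ext :: "real \<Rightarrow> (real \<Rightarrow> real) \<Rightarrow> real \<Rightarrow> real" where
  "kernel_ext \<eta> w s = (if s \<in> {0..\<eta>} then w s else 0)"

section \<open>Microscopic model\<close>

text \<open>\<open>x i t\<close> is the position of car \<open>i\<close> at time \<open>t\<close>; only \<open>i \<le> N\<close> and \<open>t \<ge> 0\<close> are meaningful.\<close>

definition gap :: "(nat \<Rightarrow> real \<Rightarrow> real) \<Rightarrow> nat \<Rightarrow> real \<Rightarrow> real" where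
  "gap x i t = x (i + 1) t - x i t"

definition car_velocity ::
  "(real \<Rightarrow> real \<Rightarrow> real) \<Rightarrow> nat \<Rightarrow> (nat \<Rightarrow> real) \<Rightarrow> real \<Rightarrow> (nat \<Rightarrow> real \<Rightarrow> real) \<Rightarrow> nat \<Rightarrow> nat \<Rightarrow> real \<Rightarrow> real"
  where
  "car_velocity v N \<omega> vbar x i j t =
     (if i + j < N then v (1 / (real N * gap x (i + j) t)) (\<omega> (i + j)) else vbar)"

definition car_weight ::
  "real \<Rightarrow> (real \<Rightarrow> real) \<Rightarrow> nat \<Rightarrow> (nat \<Rightarrow> real \<Rightarrow> real) \<Rightarrow> nat \<Rightarrow> nat \<Rightarrow> real \<Rightarrow> real"
  where
  "car_weight \<eta> w N x i j t =
     (if i + j < N then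
        integral {x (i + j) t .. x (i + j + 1) t} (\<lambda>y. kernel_ext \<eta> w (y - x i t))
      else if i + j = N then
        integral {min (x N t) (x i t + \<eta>) .. x i t + \<eta>} (\<lambda>y. kernel_ext \<eta> w (y - x i t))
      else 0)"

locale micro_model = nonlocal_kernel \<eta> w + velocity_law v rho_max
  for \<eta> :: real and w :: "real \<Rightarrow> real"
    and v :: "real \<Rightarrow> real \<Rightarrow> real" and rho_max :: "real \<Rightarrow> real" +
  fixes N N\<eta> :: nat and \<omega> :: "nat \<Rightarrow> real" and vbar :: real and x :: "nat \<Rightarrow> real \<Rightarrow> real"
  assumes ordered: "\<And>i t. i < N \<Longrightarrow> 0 \<le> t \<Longrightarrow> x i t < x (i + 1) t"
    and initially_admissible: "\<And>i. i < N \<Longrightarrow> 1 / (real N * gap x i 0) \<le> rho_max (\<omega> i)"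
    and N\<eta>_large: "\<And>i t. i + N\<eta> \<le> N \<Longrightarrow> 0 \<le> t \<Longrightarrow> \<eta> \<le> x (i + N\<eta>) t - x i t"
    and x_continuous: "\<And>i. i \<le> N \<Longrightarrow> continuous_on {0..} (x i)"
    and x_ode: "\<And>i t. i \<le> N \<Longrightarrow> 0 < t \<Longrightarrow>
          (x i has_real_derivative
             (\<Sum>j<N\<eta>. car_weight \<eta> w N x i j t * car_velocity v N \<omega> vbar x i j t)) (at t)"

text \<open>The density \<open>1 / (N * d)\<close> has to be admissible: outside \<open>{0..rho_max \<omega>}\<close> neither the sign nor the
  monotonicity of \<open>v\<close> is prescribed, so \<open>v\<close> could equal \<open>vbar\<close> there as well.\<close>

definition equilibrium_distance ::
  "(real \<Rightarrow> real \<Rightarrow> real) \<Rightarrow> (real \<Rightarrow> real) \<Rightarrow> nat \<Rightarrow> real \<Rightarrow> real \<Rightarrow> real \<Rightarrow> bool" where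
  "equilibrium_distance v rho_max N vbar \<omega> d \<longleftrightarrow>
     0 < d \<and> 1 / (real N * d) \<le> rho_max \<omega> \<and> v (1 / (real N * d)) \<omega> = vbar"

definition lyapunov :: "nat \<Rightarrow> nat \<Rightarrow> (nat \<Rightarrow> real) \<Rightarrow> (nat \<Rightarrow> real \<Rightarrow> real) \<Rightarrow> real \<Rightarrow> real" where
  "lyapunov N J Lbar x t =
     (\<Sum>i = J..<N. gap x i t * (1 / (real N * gap x i t) - 1 / (real N * Lbar i))\<^sup>2)"

definition rho_min :: "nat \<Rightarrow> nat \<Rightarrow> (nat \<Rightarrow> real) \<Rightarrow> (nat \<Rightarrow> real \<Rightarrow> real) \<Rightarrow> real" where
  "rho_min N J Lbar x =
     Min ((\<lambda>i. min (1 / (real N * gap x i 0)) (1 / (real N * Lbar i))) ` {J..<N})"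

end

theory Submission
  imports Defs
begin

text \<open>For a constant kernel, a car whose horizon reaches beyond the leader moves with velocity
  \<open>vbar\<close> plus the average over its horizon of \<open>v - vbar\<close>. Subtracting the velocities of neighbouring
  cars therefore decouples the gaps: \<open>y\<^sub>i' = - y\<^sub>i / \<eta> * (v (1 / (N * y\<^sub>i)) \<omega>\<^sub>i - vbar)\<close>. Since
  \<open>v\<close> decreases in the density, every gap stays between its initial value and its equilibrium, so
  the total length stays below \<open>\<eta>\<close> and the decoupling persists. Each summand of the Lyapunov
  function then satisfies \<open>l' \<le> 2 / \<eta> * vmax' * rho_min * l\<close>.\<close>

section \<open>Differential inequalities\<close>

text \<open>The integrating factor \<open>exp (- (C * t))\<close> turns the inequality into
  monotonicity. Derivatives are required only in the open interval since the equations of motion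
  hold only for \<open>t > 0\<close>.\<close>

lemma differential_gronwall:
  fixes f f' :: "real \<Rightarrow> real"
  assumes "a \<le> b" and cont: "continuous_on {a..b} f"
    and der: "\<And>t. a < t \<Longrightarrow> t < b \<Longrightarrow> (f has_real_derivative f' t) (at t)"
    and le: "\<And>t. a < t \<Longrightarrow> t < b \<Longrightarrow> f' t \<le> C * f t"
  shows "f b \<le> f a * exp (C * (b - a))"
proof -
  let ?g = "\<lambda>t. f t * exp (- (C * t))"
  have "?g b \<le> ?g a"
  proof (rule DERIV_nonpos_imp_decreasing_open[OF \<open>a \<le> b\<close>])
    fix t assume t: "a < t" "t < b"
    have "(?g has_real_derivative (f' t - C * f t) * exp (- (C * t))) (at t)"
      by (rule derivative_eq_intros der[OF t] refl)+ (simp add: algebra_simps)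
    moreover have "(f' t - C * f t) * exp (- (C * t)) \<le> 0"
      using le[OF t] by (simp add: mult_le_0_iff)
    ultimately show "\<exists>y. DERIV ?g t :> y \<and> y \<le> 0" by blast
  qed (intro continuous_intros cont)
  then have "?g b * exp (C * b) \<le> ?g a * exp (C * b)" by simp
  then show ?thesis by (simp add: algebra_simps flip: exp_add)
qed

text \<open>Barrier argument: to become positive, \<open>f\<close> must first cross the thin layer
  \<open>0 < f < \<delta>\<close>, and Gronwall's inequality forbids this. The dynamics of a gap
  thus need to be known only slightly outside the interval that confines it.\<close>

lemma differential_inequality_nonpos:
  fixes f f' :: "real \<Rightarrow> real"
  assumes cont: "continuous_on {a..} f" and "f a \<le> 0" and "0 < \<delta>" and "a \<le> t"
    and der: "\<And>s. a < s \<Longrightarrow> 0 < f s \<Longrightarrow> f s < \<delta> \<Longrightarrow> (f has_real_derivative f' s) (at s)"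
    and le: "\<And>s. a < s \<Longrightarrow> 0 < f s \<Longrightarrow> f s < \<delta> \<Longrightarrow> f' s \<le> C * f s"
  shows "f t \<le> 0"
proof (rule ccontr)
  assume pos: "\<not> f t \<le> 0"
  let ?S = "{a..t} \<inter> f -` {..0}"
  have cont': "continuous_on {a..t} f" by (rule continuous_on_subset[OF cont]) auto
  have "compact ?S"
    using continuous_closed_preimage[OF cont'] by (simp add: compact_eq_bounded_closed bounded_Int)
  moreover have "a \<in> ?S" using assms by simp
  \<comment> \<open>\<open>b\<close> is the last time up to \<open>t\<close> at which
    \<open>f\<close> is nonpositive.\<close>
  ultimately obtain b where b: "b \<in> ?S" "\<And>s. s \<in> ?S \<Longrightarrow> s \<le> b"
    using compact_attains_sup[of ?S] by blast
  have "b \<noteq> t" using pos b(1) by auto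
  then have bt: "a \<le> b" "b < t" "f b \<le> 0" using b(1) by auto
  have fpos: "0 < f s" if "b < s" "s \<le> t" for s
    using b(2)[of s] that bt by force
  obtain d where d: "0 < d" "\<And>s. s \<in> {a..t} \<Longrightarrow> dist s b < d \<Longrightarrow> dist (f s) (f b) < \<delta>"
    using cont' bt \<open>0 < \<delta>\<close> unfolding continuous_on_iff by (metis atLeastAtMost_iff less_imp_le)
  \<comment> \<open>On \<open>{b<..<c}\<close> continuity keeps \<open>f\<close> within \<delta> of
    \<open>f b \<le> 0\<close>, hence inside the layer.\<close>
  define c where "c = min t (b + d / 2)"
  have c: "b < c" "c \<le> t" "c < b + d" using bt d(1) by (auto simp: c_def)
  have "f c \<le> f b * exp (C * (c - b))"
  proof (rule differential_gronwall)
    show "b \<le> c" using c by simp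
    show "continuous_on {b..c} f" by (rule continuous_on_subset[OF cont]) (use bt in auto)
    fix s assume s: "b < s" "s < c"
    have "dist (f s) (f b) < \<delta>" using d(2)[of s] s c bt by (simp add: dist_real_def)
    then have fs: "a < s" "0 < f s" "f s < \<delta>"
      using fpos[of s] s c bt by (simp_all add: dist_real_def)
    show "(f has_real_derivative f' s) (at s)" by (rule der[OF fs])
    show "f' s \<le> C * f s" by (rule le[OF fs])
  qed
  also have "\<dots> \<le> 0" using bt by (simp add: mult_le_0_iff)
  finally show False using fpos[of c] c by simp
qed

section \<open>Velocity as a function of the density\<close>

lemma (in velocity_law) partial_rho_works:
  assumes "0 \<le> \<omega>" "0 \<le> \<rho>"
  shows "((\<lambda>r. v r \<omega>) has_real_derivative partial_rho v \<rho> \<omega>) (at \<rho> within {0..})"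
  using C2_in_rho[OF assms(1)] assms(2)
  unfolding C2_nn_def C1_nn_def partial_rho_def deriv_nn_def differentiable_on_def
  by (simp add: has_real_derivative_iff_has_vector_derivative flip: vector_derivative_works)

lemma (in velocity_law) continuous_on_v:
  assumes "0 \<le> \<omega>"
  shows "continuous_on {0..} (\<lambda>r. v r \<omega>)"
  using partial_rho_works[OF assms]
  by (meson DERIV_continuous atLeast_iff continuous_on_eq_continuous_within)

text \<open>The bound on the slope makes \<open>v r \<omega> - K * r\<close> decreasing. Interior
  derivatives suffice, so \<open>a = 0\<close>, where the derivative is one-sided, is
  covered.\<close>

lemma (in velocity_law) v_diff_le:
  assumes "0 \<le> \<omega>" "0 \<le> a" "a \<le> b"
    and "\<And>\<rho>. \<rho> \<in> {a..b} \<Longrightarrow> partial_rho v \<rho> \<omega> \<le> K"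
  shows "v b \<omega> - v a \<omega> \<le> K * (b - a)"
proof -
  let ?g = "\<lambda>r. v r \<omega> - K * r"
  have "?g b \<le> ?g a"
  proof (rule DERIV_nonpos_imp_decreasing_open[OF \<open>a \<le> b\<close>])
    fix r assume r: "a < r" "r < b"
    have "at r within {0..} = at r"
      using r assms by (intro at_within_interior) simp
    then have "((\<lambda>r. v r \<omega>) has_real_derivative partial_rho v r \<omega>) (at r)"
      using partial_rho_works[of \<omega> r] r assms by simp
    then have "(?g has_real_derivative partial_rho v r \<omega> - K) (at r)"
      by (auto intro!: derivative_eq_intros)
    moreover have "partial_rho v r \<omega> - K \<le> 0" using assms(4)[of r] r by simp
    ultimately show "\<exists>y. DERIV ?g r :> y \<and> y \<le> 0" by blast
  next
    show "continuous_on {a..b} ?g"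
      by (intro continuous_intros continuous_on_subset[OF continuous_on_v[OF assms(1)]])
        (use assms in auto)
  qed
  then show ?thesis by (simp add: algebra_simps)
qed

section \<open>Dynamics for a constant kernel\<close>

text \<open>The integral is the length of the overlap of \<open>{p..q}\<close> with the horizon,
  divided by \<eta>. Truncating both endpoints by \<open>min\<close> also covers intervals beyond
  the horizon and lets consecutive weights telescope.\<close>

lemma integral_constant_kernel:
  assumes "0 < \<eta>" and w: "\<And>s. s \<in> {0..\<eta>} \<Longrightarrow> w s = 1 / \<eta>" and "a \<le> p" "p \<le> q"
  shows "integral {p..q} (\<lambda>y. kernel_ext \<eta> w (y - a)) = (min q (a + \<eta>) - min p (a + \<eta>)) / \<eta>"
proof -
  have eq: "(\<lambda>y. kernel_ext \<eta> w (y - a)) = (\<lambda>y. if y \<in> {a..a + \<eta>} then 1 / \<eta> else 0)"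
    by (auto simp: kernel_ext_def w fun_eq_iff)
  have "{p..q} \<inter> {a..a + \<eta>} = {p..min q (a + \<eta>)}" using assms by auto
  then show ?thesis
    unfolding eq integral_restrict_Int using assms by (auto simp: min_def)
qed

locale constant_kernel_model = micro_model +
  assumes N_pos: "1 \<le> N"
    and w_const: "\<And>s. s \<in> {0..\<eta>} \<Longrightarrow> w s = 1 / \<eta>"
begin

section \<open>Weights and velocities for a constant kernel\<close>

lemma gap_pos: "i < N \<Longrightarrow> 0 \<le> t \<Longrightarrow> 0 < gap x i t"
  using ordered[of i t] by (simp add: gap_def)

lemma positions_mono: "i \<le> k \<Longrightarrow> k \<le> N \<Longrightarrow> 0 \<le> t \<Longrightarrow> x i t \<le> x k t"
proof (induction k rule: dec_induct)
  case (step k)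
  then show ?case using ordered[of k t] by simp
qed simp

lemma sum_gap: "i \<le> k \<Longrightarrow> (\<Sum>l=i..<k. gap x l t) = x k t - x i t"
  using sum_Suc_diff'[of i k "\<lambda>l. x l t"] by (simp add: gap_def)

definition V :: "nat \<Rightarrow> real \<Rightarrow> real" where
  "V k t = v (1 / (real N * gap x k t)) (\<omega> k)"

lemma car_weight_eq:
  assumes "i + j < N" "0 \<le> t"
  shows "car_weight \<eta> w N x i j t =
    (min (x (i + j + 1) t) (x i t + \<eta>) - min (x (i + j) t) (x i t + \<eta>)) / \<eta>"
  unfolding car_weight_def
  using assms ordered[of "i + j" t] positions_mono[of i "i + j" t]
  by (subst integral_constant_kernel[OF eta_pos]) (auto simp: w_const)

lemma car_weight_last:
  assumes "i \<le> N" "0 \<le> t"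
  shows "car_weight \<eta> w N x i (N - i) t = (x i t + \<eta> - min (x N t) (x i t + \<eta>)) / \<eta>"
  unfolding car_weight_def
  using assms positions_mono[of i N t] eta_pos
  by (subst integral_constant_kernel[OF eta_pos]) (auto simp: w_const)

lemma car_weight_eq_0:
  assumes "i \<le> N" "0 \<le> t" "N\<eta> \<le> j \<or> N < i + j"
  shows "car_weight \<eta> w N x i j t = 0"
proof (cases "N < i + j")
  case False
  then have far: "x i t + \<eta> \<le> x (i + j) t"
    using assms N\<eta>_large[of i t] positions_mono[of "i + N\<eta>" "i + j" t] by simp
  show ?thesis
  proof (cases "i + j = N")
    case True
    then show ?thesis using far car_weight_last[of i t] assms by (auto simp: min_def)
  next
    case less: False
    then show ?thesis
      using False far assms ordered[of "i + j" t] by (simp add: car_weight_eq)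
  qed
qed (simp add: car_weight_def)

text \<open>The overlaps telescope and the leader's weight is their complement, so all weights sum
  to 1 and \<open>vbar\<close> can be split off.\<close>

lemma car_velocity_sum:
  assumes "i \<le> N" "0 \<le> t"
  shows "(\<Sum>j<N\<eta>. car_weight \<eta> w N x i j t * car_velocity v N \<omega> vbar x i j t) =
    vbar + (\<Sum>k=i..<N. (min (x (k + 1) t) (x i t + \<eta>) - min (x k t) (x i t + \<eta>)) * (V k t - vbar)) / \<eta>"
proof -
  let ?a = "x i t + \<eta>"
  let ?f = "\<lambda>j. car_weight \<eta> w N x i j t * car_velocity v N \<omega> vbar x i j t"
  let ?d = "\<lambda>k. min (x (k + 1) t) ?a - min (x k t) ?a"
  \<comment> \<open>Neither of \<open>N\<eta>\<close> and \<open>N - i + 1\<close> need be the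
    smaller one, so the sum is first enlarged to a range containing both and then cut down.\<close>
  have "(\<Sum>j<N\<eta>. ?f j) = (\<Sum>j<N\<eta> + N + 1. ?f j)"
    by (rule sum.mono_neutral_left) (auto simp: car_weight_eq_0[OF assms])
  also have "\<dots> = (\<Sum>j<Suc (N - i). ?f j)"
    by (rule sum.mono_neutral_right) (use assms in \<open>auto intro!: car_weight_eq_0\<close>)
  also have "\<dots> = (\<Sum>j<N - i. ?f j) + (?a - min (x N t) ?a) / \<eta> * vbar"
    using assms by (simp add: car_weight_last car_velocity_def)
  also have "(\<Sum>j<N - i. ?f j) = (\<Sum>j<N - i. ?d (i + j) / \<eta> * V (i + j) t)"
    using assms by (intro sum.cong) (auto simp: car_weight_eq car_velocity_def V_def)
  also have "\<dots> = (\<Sum>k=i..<N. ?d k / \<eta> * V k t)"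
    by (simp add: sum.atLeastLessThan_shift_0[of _ i N] lessThan_atLeast0 add.commute)
  finally have sum: "(\<Sum>j<N\<eta>. ?f j) = (\<Sum>k=i..<N. ?d k / \<eta> * V k t) + (?a - min (x N t) ?a) / \<eta> * vbar" .
  have "(\<Sum>k=i..<N. ?d k) = min (x N t) ?a - x i t"
    using sum_Suc_diff'[OF assms(1), of "\<lambda>k. min (x k t) ?a"] eta_pos by simp
  then have "?a - min (x N t) ?a = \<eta> - (\<Sum>k=i..<N. ?d k)" by simp
  moreover have "(\<Sum>k=i..<N. ?d k / \<eta> * V k t) = (\<Sum>k=i..<N. ?d k * V k t) / \<eta>"
    by (simp add: sum_divide_distrib)
  moreover have "(\<Sum>k=i..<N. ?d k * (V k t - vbar)) = (\<Sum>k=i..<N. ?d k * V k t) - (\<Sum>k=i..<N. ?d k) * vbar"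
    by (subst right_diff_distrib) (simp only: sum_subtractf[of "\<lambda>k. ?d k * V k t"] sum_distrib_right)
  moreover have "A / \<eta> + (\<eta> - D) / \<eta> * vbar = vbar + (A - D * vbar) / \<eta>" for A D
    using eta_pos by (simp add: field_simps)
  ultimately show ?thesis
    unfolding sum by (simp only:)
qed

text \<open>While car \<open>N - 1\<close> is within the horizon, only the last gap can be
  truncated; the \<open>max\<close> term is the length by which the leader exceeds the
  horizon.\<close>

lemma position_derivative:
  assumes "i \<le> N" "0 < t" "x (N - 1) t \<le> x i t + \<eta>"
  shows "(x i has_real_derivative vbar + ((\<Sum>k=i..<N. gap x k t * (V k t - vbar))
    - max 0 (x N t - x i t - \<eta>) * (V (N - 1) t - vbar)) / \<eta>) (at t)"
proof -
  let ?a = "x i t + \<eta>"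
  let ?z = "max 0 (x N t - x i t - \<eta>)"
  have "(\<Sum>k=i..<N. (min (x (k + 1) t) ?a - min (x k t) ?a) * (V k t - vbar))
    = (\<Sum>k=i..<N. gap x k t * (V k t - vbar) - (if k = N - 1 then ?z * (V (N - 1) t - vbar) else 0))"
  proof (rule sum.cong[OF refl])
    fix k assume k: "k \<in> {i..<N}"
    then have "x k t \<le> ?a"
      using positions_mono[of k "N - 1" t] assms by fastforce
    moreover have "x (k + 1) t \<le> ?a" if "k \<noteq> N - 1"
      using positions_mono[of "k + 1" "N - 1" t] assms that k by fastforce
    moreover have "min (x N t) ?a = x N t - ?z" by (simp add: min_def max_def)
    ultimately have "min (x (k + 1) t) ?a - min (x k t) ?a = gap x k t - (if k = N - 1 then ?z else 0)"
      using N_pos by (auto simp: gap_def)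
    then show "(min (x (k + 1) t) ?a - min (x k t) ?a) * (V k t - vbar)
      = gap x k t * (V k t - vbar) - (if k = N - 1 then ?z * (V (N - 1) t - vbar) else 0)"
      by (simp only: left_diff_distrib) simp
  qed
  also have "\<dots> = (\<Sum>k=i..<N. gap x k t * (V k t - vbar)) - ?z * (V (N - 1) t - vbar)"
    \<comment> \<open>For \<open>i = N\<close> the sum is empty and the excess is
      \<open>max 0 (- \<eta>) = 0\<close>.\<close>
    using assms(1) N_pos eta_pos by (cases "i = N") (auto simp: sum_subtractf)
  finally show ?thesis
    using x_ode[OF assms(1,2)] car_velocity_sum[OF assms(1), of t] assms(2) by simp
qed

text \<open>In the difference of the two velocities only the term of gap \<open>i\<close> survives.
  The leader must lie within the horizon of car \<open>i + 1\<close>, but may have left that of car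
  \<open>i\<close>; this case occurs in the proof of the upper bound on the gap.\<close>

lemma gap_derivative:
  assumes "i < N" "0 < t" "x (N - 1) t \<le> x i t + \<eta>" "x N t \<le> x (i + 1) t + \<eta>"
  shows "(gap x i has_real_derivative
    (max 0 (x N t - x i t - \<eta>) * (V (N - 1) t - vbar) - gap x i t * (V i t - vbar)) / \<eta>) (at t)"
proof -
  have "x (N - 1) t \<le> x (i + 1) t + \<eta>"
    using assms positions_mono[of "N - 1" N t] by simp
  then have "((\<lambda>t. x (i + 1) t - x i t) has_real_derivative
      (vbar + ((\<Sum>k=i + 1..<N. gap x k t * (V k t - vbar))
        - max 0 (x N t - x (i + 1) t - \<eta>) * (V (N - 1) t - vbar)) / \<eta>)
      - (vbar + ((\<Sum>k=i..<N. gap x k t * (V k t - vbar))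
        - max 0 (x N t - x i t - \<eta>) * (V (N - 1) t - vbar)) / \<eta>)) (at t)"
    using assms by (intro DERIV_diff position_derivative) auto
  moreover have "gap x i = (\<lambda>t. x (i + 1) t - x i t)" by (simp add: gap_def fun_eq_iff)
  moreover have "max 0 (x N t - x (i + 1) t - \<eta>) = 0" using assms by simp
  ultimately show ?thesis
    using assms(1) by (simp add: sum.atLeast_Suc_lessThan diff_divide_distrib add_divide_distrib)
qed

lemma continuous_on_gap: "i < N \<Longrightarrow> continuous_on {0..} (gap x i)"
  unfolding gap_def[abs_def] by (intro continuous_intros x_continuous) auto

end

section \<open>Relaxation of the gaps near the leader\<close>

locale relaxation_model = constant_kernel_model +
  fixes Lbar :: "nat \<Rightarrow> real" and vmax' :: real and J :: nat
  assumes omega_pos: "\<And>i. i < N \<Longrightarrow> 0 < \<omega> i"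
    and vbar_pos: "0 < vbar"
    and vbar_le: "\<And>i. i < N \<Longrightarrow> vbar \<le> \<omega> i"
    and equilibrium: "\<And>i. i < N \<Longrightarrow> equilibrium_distance v rho_max N vbar (\<omega> i) (Lbar i)"
    and vmax'_neg: "vmax' < 0"
    and partial_rho_le: "\<And>i \<rho>. i < N \<Longrightarrow> \<rho> \<in> {0..rho_max (\<omega> i)} \<Longrightarrow> partial_rho v \<rho> (\<omega> i) \<le> vmax'"
    and horizon: "(\<Sum>i=J..<N. max (gap x i 0) (Lbar i)) \<le> \<eta>"
begin

section \<open>Velocities for gaps between the initial and the equilibrium value\<close>

definition lower :: "nat \<Rightarrow> real" where "lower i = min (gap x i 0) (Lbar i)"
definition upper :: "nat \<Rightarrow> real" where "upper i = max (gap x i 0) (Lbar i)"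

lemma Lbar:
  assumes "i < N"
  shows "0 < Lbar i" "1 / (real N * Lbar i) \<le> rho_max (\<omega> i)" "v (1 / (real N * Lbar i)) (\<omega> i) = vbar"
  using equilibrium[OF assms] by (auto simp: equilibrium_distance_def)

lemma lower_pos: "i < N \<Longrightarrow> 0 < lower i"
  using Lbar(1) gap_pos[of i 0] by (simp add: lower_def)

lemma upper_pos: "i < N \<Longrightarrow> 0 < upper i"
  using Lbar(1) by (simp add: upper_def less_max_iff_disj)

lemma density_antimono: "0 < g \<Longrightarrow> g \<le> h \<Longrightarrow> 1 / (real N * h) \<le> 1 / (real N * g)"
  using N_pos by (simp add: field_simps)

lemma lower_admissible: "i < N \<Longrightarrow> 1 / (real N * lower i) \<le> rho_max (\<omega> i)"
  using Lbar(2) initially_admissible by (simp add: lower_def min_def)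

lemma admissible:
  assumes "i < N" "lower i \<le> g"
  shows "0 \<le> 1 / (real N * g)" "1 / (real N * g) \<le> rho_max (\<omega> i)"
  using lower_pos[OF assms(1)] density_antimono[of "lower i" g] lower_admissible[OF assms(1)] assms
  by auto

lemma v_decrease:
  assumes "i < N" "0 \<le> a" "a \<le> b" "b \<le> rho_max (\<omega> i)"
  shows "v b (\<omega> i) - v a (\<omega> i) \<le> vmax' * (b - a)"
  using assms omega_pos[of i] by (intro v_diff_le partial_rho_le) auto

lemma v_antimono:
  assumes "i < N" "0 \<le> a" "a \<le> b" "b \<le> rho_max (\<omega> i)"
  shows "v b (\<omega> i) \<le> v a (\<omega> i)"
proof -
  have "vmax' * (b - a) \<le> 0" using vmax'_neg assms by (simp add: mult_le_0_iff)
  then show ?thesis using v_decrease[OF assms] by simp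
qed

text \<open>A gap above equilibrium has a density below the equilibrium density, hence still
  admissible, and \<open>v\<close> is antitone there.\<close>

lemma V_ge_vbar:
  assumes "i < N" "Lbar i \<le> gap x i t"
  shows "vbar \<le> V i t"
  using v_antimono[OF assms(1), of "1 / (real N * gap x i t)" "1 / (real N * Lbar i)"]
    density_antimono[OF Lbar(1) assms(2)] Lbar[OF assms(1)] assms
  by (simp add: V_def)

text \<open>The speed is compared with the one on an empty road,
  \<open>v 0 \<omega> = \<omega>\<close>. This bounds the growth rate while the leader is out of
  reach.\<close>

lemma V_le_omega:
  assumes "i < N" "lower i \<le> gap x i t"
  shows "V i t \<le> \<omega> i"
  using v_antimono[OF assms(1) order_refl admissible[OF assms]] v_zero_rho omega_pos assms
  by (simp add: V_def)

text \<open>Below \<open>lower i\<close> the density may leave the admissible range, where nothing is known about the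
  sign of \<open>v - vbar\<close>; a small margin suffices, by continuity and \<open>v (rho_max \<omega>) \<omega> = 0 < vbar\<close>.\<close>

lemma lower_margin:
  assumes i: "i < N"
  obtains \<delta> where "0 < \<delta>"
    "\<And>t. 0 \<le> t \<Longrightarrow> lower i - \<delta> < gap x i t \<Longrightarrow> gap x i t < lower i \<Longrightarrow> V i t \<le> vbar"
proof -
  let ?\<rho> = "1 / (real N * lower i)"
  have N: "0 < real N" using N_pos by simp
  have \<rho>: "0 < ?\<rho>" using lower_pos[OF i] N by simp
  have "\<exists>r>?\<rho>. \<forall>s. ?\<rho> \<le> s \<and> s < r \<longrightarrow> v s (\<omega> i) \<le> vbar"
  proof (cases "?\<rho> = rho_max (\<omega> i)")
    case True
    then have "v ?\<rho> (\<omega> i) = 0" using v_rho_max omega_pos[OF i] by simp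
    moreover have "continuous_on {0..} (\<lambda>r. v r (\<omega> i))"
      using continuous_on_v omega_pos[OF i] by simp
    ultimately obtain d where d: "0 < d"
      "\<And>s. s \<in> {0..} \<Longrightarrow> dist s ?\<rho> < d \<Longrightarrow> dist (v s (\<omega> i)) 0 < vbar"
      using \<rho> vbar_pos unfolding continuous_on_iff by (metis atLeast_iff less_imp_le)
    have "v s (\<omega> i) \<le> vbar" if "?\<rho> \<le> s" "s < ?\<rho> + d" for s
      using d(2)[of s] that \<rho> by (simp add: dist_real_def)
    then show ?thesis using d(1) by (intro exI[of _ "?\<rho> + d"]) auto
  next
    case False
    \<comment> \<open>Below \<open>rho_max\<close> there is still room for monotonicity, starting
      from the equilibrium density.\<close>
    have "v s (\<omega> i) \<le> vbar" if "?\<rho> \<le> s" "s < rho_max (\<omega> i)" for s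
    proof -
      have "1 / (real N * Lbar i) \<le> ?\<rho>"
        using density_antimono[of "lower i" "Lbar i"] lower_pos[OF i] by (simp add: lower_def)
      then show ?thesis
        using v_antimono[OF i, of "1 / (real N * Lbar i)" s] Lbar[OF i] that by simp
    qed
    then show ?thesis
      using False lower_admissible[OF i] by (intro exI[of _ "rho_max (\<omega> i)"]) auto
  qed
  then obtain r where r: "?\<rho> < r" "\<And>s. ?\<rho> \<le> s \<Longrightarrow> s < r \<Longrightarrow> v s (\<omega> i) \<le> vbar"
    by blast
  show thesis
  proof (rule that)
    \<comment> \<open>A gap above \<open>1 / (real N * r)\<close> has density below
      \<open>r\<close>; this determines the margin.\<close>
    show "0 < lower i - 1 / (real N * r)"
      using r(1) lower_pos[OF i] N order_less_trans[OF \<rho> r(1)] by (simp add: field_simps)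
  next
    fix t assume t: "0 \<le> t" "lower i - (lower i - 1 / (real N * r)) < gap x i t" "gap x i t < lower i"
    have g: "0 < gap x i t" using gap_pos i t by simp
    have "1 / (real N * gap x i t) < r"
      using t(2) g N order_less_trans[OF \<rho> r(1)] by (simp add: field_simps)
    then show "V i t \<le> vbar"
      unfolding V_def using r(2) density_antimono[OF g, of "lower i"] t by simp
  qed
qed

section \<open>Confinement of the gaps\<close>

lemma sum_upper:
  assumes "J \<le> i" "i \<le> N"
  shows "(\<Sum>k=i..<N. upper k) \<le> \<eta>"
proof -
  have "(\<Sum>k=i..<N. upper k) \<le> (\<Sum>k=J..<N. upper k)"
    using assms by (intro sum_mono2) (auto simp: upper_pos less_imp_le)
  then show ?thesis using horizon by (simp add: upper_def)
qed

text \<open>When \<open>sum_upper\<close> is an equality, the leader might leave the horizon of car \<open>i\<close>, so its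
  velocity also has to be controlled there: the excess length is at most \<open>gap x i t - upper i\<close>.\<close>

lemma gap_bounds_step:
  assumes i: "J \<le> i" "i < N"
    and IH: "\<And>k t. i < k \<Longrightarrow> k < N \<Longrightarrow> 0 \<le> t \<Longrightarrow> lower k \<le> gap x k t \<and> gap x k t \<le> upper k"
    and "0 \<le> t"
  shows "lower i \<le> gap x i t \<and> gap x i t \<le> upper i"
proof -
  \<comment> \<open>The gaps ahead of car \<open>i + 1\<close> sum to at most
    \<open>\<eta> - upper i\<close>, by the induction hypothesis and
    \<open>sum_upper\<close>.\<close>
  have ahead: "x N t - x i t - \<eta> \<le> gap x i t - upper i" "x N t \<le> x (i + 1) t + \<eta>"
    if "0 \<le> t" for t
  proof -
    have "(\<Sum>k=i + 1..<N. gap x k t) \<le> (\<Sum>k=i + 1..<N. upper k)"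
      using IH that by (intro sum_mono) auto
    moreover have "(\<Sum>k=i..<N. upper k) = upper i + (\<Sum>k=i + 1..<N. upper k)"
      using i by (simp add: sum.atLeast_Suc_lessThan)
    ultimately have "x N t - x (i + 1) t \<le> \<eta> - upper i"
      using sum_upper[of i] sum_gap[of "i + 1" N t] i by simp
    then show "x N t - x i t - \<eta> \<le> gap x i t - upper i" "x N t \<le> x (i + 1) t + \<eta>"
      using upper_pos[OF i(2)] by (simp_all add: gap_def)
  qed
  have last: "gap x (N - 1) t = x N t - x (N - 1) t" for t
    using N_pos by (simp add: gap_def)
  \<comment> \<open>An excess of gap \<open>i\<close> smaller than \<open>lower (N - 1)\<close> is
    absorbed by the last gap, so car \<open>N - 1\<close> stays within the horizon. Hence this is
    the layer width for the upper bound.\<close>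
  have reach: "x (N - 1) t \<le> x i t + \<eta>"
    if "0 \<le> t" "gap x i t - upper i < lower (N - 1)" for t
  proof (cases "i = N - 1")
    case False
    then have "lower (N - 1) \<le> gap x (N - 1) t" using IH i that by simp
    then show ?thesis using ahead(1)[OF that(1)] that last[of t] by simp
  qed (use eta_pos in simp)
  have u: "gap x i t \<le> upper i" if "0 \<le> t" for t
  proof -
    let ?D = "\<lambda>s. (max 0 (x N s - x i s - \<eta>) * (V (N - 1) s - vbar) - gap x i s * (V i s - vbar)) / \<eta>"
    \<comment> \<open>In \<open>?D\<close> the relaxation term has a favourable sign above
      equilibrium; in the other term the excess is at most \<open>gap x i s - upper i\<close> and
      \<open>V (N - 1) s \<le> \<omega> (N - 1)\<close>.\<close>
    let ?C = "(\<omega> (N - 1) - vbar) / \<eta>"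
    have "gap x i t - upper i \<le> 0"
    proof (rule differential_inequality_nonpos[where f = "\<lambda>s. gap x i s - upper i" and f' = ?D and C = ?C and a = 0])
      show "continuous_on {0..} (\<lambda>s. gap x i s - upper i)"
        by (intro continuous_intros continuous_on_gap i)
      show "gap x i 0 - upper i \<le> 0" by (simp add: upper_def)
      show "0 < lower (N - 1)" using lower_pos N_pos by simp
    next
      fix s :: real assume s: "0 < s" "0 < gap x i s - upper i" "gap x i s - upper i < lower (N - 1)"
      have "(gap x i has_real_derivative ?D s) (at s)"
        using s i reach ahead by (intro gap_derivative) auto
      then show "((\<lambda>s. gap x i s - upper i) has_real_derivative ?D s) (at s)"
        by (auto intro!: derivative_eq_intros)
      let ?z = "max 0 (x N s - x i s - \<eta>)"
      have z: "0 \<le> ?z" "?z \<le> gap x i s - upper i" using ahead(1)[of s] s by auto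
      have "lower (N - 1) \<le> gap x (N - 1) s"
      \<comment> \<open>For \<open>i = N - 1\<close> the induction hypothesis is silent, but the gap
        exceeds \<open>upper i\<close> in the layer.\<close>
      proof (cases "i = N - 1")
        case True
        have "lower i \<le> upper i" by (simp add: lower_def upper_def)
        then show ?thesis using True s by simp
      qed (use IH s i in auto)
      then have "V (N - 1) s \<le> \<omega> (N - 1)" using V_le_omega N_pos by simp
      then have "?z * (V (N - 1) s - vbar) \<le> ?z * (\<omega> (N - 1) - vbar)"
        using z(1) by (intro mult_left_mono) auto
      also have "\<dots> \<le> (gap x i s - upper i) * (\<omega> (N - 1) - vbar)"
        using z(2) vbar_le[of "N - 1"] N_pos by (intro mult_right_mono) auto
      finally have "?z * (V (N - 1) s - vbar) \<le> (\<omega> (N - 1) - vbar) * (gap x i s - upper i)"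
        by (simp add: mult.commute)
      moreover have "0 \<le> gap x i s * (V i s - vbar)"
        using V_ge_vbar[OF i(2), of s] gap_pos[OF i(2), of s] s by (auto simp: upper_def)
      ultimately show "?D s \<le> ?C * (gap x i s - upper i)"
        using eta_pos by (simp add: divide_right_mono)
    qed (use that in auto)
    then show ?thesis by simp
  qed
  obtain \<delta> where \<delta>: "0 < \<delta>"
    "\<And>t. 0 \<le> t \<Longrightarrow> lower i - \<delta> < gap x i t \<Longrightarrow> gap x i t < lower i \<Longrightarrow> V i t \<le> vbar"
    using lower_margin[OF i(2)] by blast
  have "lower i - gap x i t \<le> 0"
  \<comment> \<open>By \<open>u\<close> the leader is now within the horizon, so the coupling term
    vanishes. Just below \<open>lower i\<close> the velocity is at most \<open>vbar\<close>, so the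
    gap cannot shrink and the rate 0 suffices.\<close>
  proof (rule differential_inequality_nonpos[where f = "\<lambda>s. lower i - gap x i s"
        and f' = "\<lambda>s. gap x i s * (V i s - vbar) / \<eta>" and C = 0 and a = 0 and \<delta> = \<delta>])
    show "continuous_on {0..} (\<lambda>s. lower i - gap x i s)"
      by (intro continuous_intros continuous_on_gap i)
    show "lower i - gap x i 0 \<le> 0" by (simp add: lower_def)
  next
    fix s :: real assume s: "0 < s" "0 < lower i - gap x i s" "lower i - gap x i s < \<delta>"
    have "x (N - 1) s \<le> x i s + \<eta>" "x N s \<le> x (i + 1) s + \<eta>" "x N s - x i s - \<eta> \<le> 0"
      using reach[of s] ahead[of s] u[of s] lower_pos[of "N - 1"] s N_pos by auto
    from gap_derivative[OF i(2) s(1) this(1,2)] this(3)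
    show "((\<lambda>s. lower i - gap x i s) has_real_derivative gap x i s * (V i s - vbar) / \<eta>) (at s)"
      by (auto intro!: derivative_eq_intros simp: max_absorb1)
    show "gap x i s * (V i s - vbar) / \<eta> \<le> 0 * (lower i - gap x i s)"
      using \<delta>(2)[of s] gap_pos[OF i(2), of s] s eta_pos
      by (simp add: divide_le_0_iff mult_le_0_iff)
  qed (use \<delta> \<open>0 \<le> t\<close> in auto)
  then show ?thesis using u \<open>0 \<le> t\<close> by simp
qed

text \<open>Induction runs backwards from the leader, since each gap is controlled through all gaps
  ahead of it.\<close>

lemma gap_bounds:
  assumes "J \<le> i" "i < N" "0 \<le> t"
  shows "lower i \<le> gap x i t" "gap x i t \<le> upper i"
proof -
  have "lower i \<le> gap x i t \<and> gap x i t \<le> upper i"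
    using assms
  proof (induction "N - i" arbitrary: i t rule: less_induct)
    case less
    show ?case
      by (rule gap_bounds_step) (use less in auto)
  qed
  then show "lower i \<le> gap x i t" "gap x i t \<le> upper i" by auto
qed

text \<open>The upper bounds sum to at most \<eta>, so the leader never leaves the horizon of car
  \<open>i\<close> and the excess term is 0.\<close>

lemma gap_decoupled:
  assumes "J \<le> i" "i < N" "0 < t"
  shows "(gap x i has_real_derivative gap x i t * (vbar - V i t) / \<eta>) (at t)"
proof -
  have "(\<Sum>k=i..<N. gap x k t) \<le> (\<Sum>k=i..<N. upper k)"
    using assms gap_bounds by (intro sum_mono) auto
  then have "x N t - x i t \<le> \<eta>"
    using sum_upper[of i] sum_gap[of i N t] assms by simp
  moreover have "x i t \<le> x (i + 1) t" "x (N - 1) t \<le> x N t"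
    using assms positions_mono by auto
  ultimately have "x (N - 1) t \<le> x i t + \<eta>" "x N t \<le> x (i + 1) t + \<eta>" "x N t - x i t - \<eta> \<le> 0"
    by auto
  from gap_derivative[OF assms(2,3) this(1,2)] this(3)
  show ?thesis by (simp add: max_absorb1 algebra_simps)
qed

section \<open>Decay of the Lyapunov function\<close>

lemma rho_min_le:
  assumes "J \<le> i" "i < N" "0 \<le> t"
  shows "rho_min N J Lbar x \<le> 1 / (real N * gap x i t)" "rho_min N J Lbar x \<le> 1 / (real N * Lbar i)"
proof -
  have le: "rho_min N J Lbar x \<le> min (1 / (real N * gap x i 0)) (1 / (real N * Lbar i))"
    unfolding rho_min_def using assms by (intro Min_le) auto
  then show "rho_min N J Lbar x \<le> 1 / (real N * Lbar i)" by simp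
  \<comment> \<open>Confinement by \<open>upper i\<close> extends the bound from the initial density
    to all times.\<close>
  have "1 / (real N * upper i) \<le> 1 / (real N * gap x i t)"
    using density_antimono gap_pos gap_bounds(2) assms by blast
  moreover have "rho_min N J Lbar x \<le> 1 / (real N * upper i)"
    using le by (simp add: upper_def max_def)
  ultimately show "rho_min N J Lbar x \<le> 1 / (real N * gap x i t)" by simp
qed

text \<open>Both densities are admissible, so the slope bound applies between them in either order;
  the sign of their difference decides the order, and multiplying by that difference gives the
  square.\<close>

lemma V_dissipation:
  assumes "J \<le> i" "i < N" "0 \<le> t"
  shows "(1 / (real N * gap x i t) - 1 / (real N * Lbar i)) * (V i t - vbar)
    \<le> vmax' * (1 / (real N * gap x i t) - 1 / (real N * Lbar i))\<^sup>2"
proof -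
  let ?r = "1 / (real N * gap x i t)" and ?s = "1 / (real N * Lbar i)"
  have r: "0 \<le> ?r" "?r \<le> rho_max (\<omega> i)" using admissible gap_bounds(1) assms by auto
  have s: "0 \<le> ?s" "?s \<le> rho_max (\<omega> i)" "v ?s (\<omega> i) = vbar"
    using Lbar[OF assms(2)] by auto
  have "(?r - ?s) * (V i t - vbar) \<le> (?r - ?s) * (vmax' * (?r - ?s))"
  proof (cases "?s \<le> ?r")
    case True
    then show ?thesis
      using v_decrease[OF assms(2) s(1) True r(2)] s(3) unfolding V_def
      by (intro mult_left_mono) auto
  next
    case False
    then have "vmax' * (?r - ?s) \<le> V i t - vbar"
      using v_decrease[OF assms(2) r(1) _ s(2)] s(3) unfolding V_def by (simp add: algebra_simps)
    then show ?thesis using False by (intro mult_left_mono_neg) auto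
  qed
  then show ?thesis by (simp add: power2_eq_square mult_ac)
qed

lemma lyapunov_summand_decay:
  assumes i: "J \<le> i" "i < N" and "0 \<le> t"
  defines "l \<equiv> \<lambda>t. gap x i t * (1 / (real N * gap x i t) - 1 / (real N * Lbar i))\<^sup>2"
  shows "l t \<le> l 0 * exp (2 / \<eta> * vmax' * rho_min N J Lbar x * t)"
proof -
  let ?r = "\<lambda>t. 1 / (real N * gap x i t)" and ?s = "1 / (real N * Lbar i)"
  let ?D = "\<lambda>t. gap x i t / \<eta> * (?r t + ?s) * ((?r t - ?s) * (V i t - vbar))"
  have N: "0 < real N" using N_pos by simp
  have "l t \<le> l 0 * exp (2 / \<eta> * vmax' * rho_min N J Lbar x * (t - 0))"
  proof (rule differential_gronwall[where f' = ?D])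
    have "gap x i s \<noteq> 0" if "0 \<le> s" for s
      using gap_pos[OF i(2) that] by simp
    then show "continuous_on {0..t} l"
      unfolding l_def using N
      by (intro continuous_intros continuous_on_subset[OF continuous_on_gap[OF i(2)]]) auto
  next
    fix s assume s: "0 < s" "s < t"
    have g: "0 < gap x i s" using gap_pos i s by simp
    \<comment> \<open>Expanding the square gives
      \<open>1 / (N\<^sup>2 * y) - 2 * ?s / N + ?s\<^sup>2 * y\<close>, whose derivative is
      \<open>?s\<^sup>2 - 1 / (N * y)\<^sup>2\<close>.\<close>
    have "((\<lambda>y. y * (1 / (real N * y) - ?s)\<^sup>2) has_real_derivative - (?r s - ?s) * (?r s + ?s)) (at (gap x i s))"
      using N g Lbar(1)[OF i(2)]
      by (auto intro!: derivative_eq_intros) (simp add: field_simps power2_eq_square)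
    from DERIV_chain2[OF this gap_decoupled[OF i s(1)]]
    have "(l has_real_derivative
      - (?r s - ?s) * (?r s + ?s) * (gap x i s * (vbar - V i s) / \<eta>)) (at s)"
      unfolding l_def .
    then show "(l has_real_derivative ?D s) (at s)"
      by (rule DERIV_cong) (simp add: algebra_simps diff_divide_distrib)
    have "0 \<le> gap x i s / \<eta> * (?r s + ?s)"
      using g N Lbar(1)[OF i(2)] eta_pos by (intro mult_nonneg_nonneg) auto
    then have "?D s \<le> gap x i s / \<eta> * (?r s + ?s) * (vmax' * (?r s - ?s)\<^sup>2)"
      using V_dissipation[OF i] s by (intro mult_left_mono) auto
    also have "\<dots> = vmax' * (?r s - ?s)\<^sup>2 * (gap x i s / \<eta>) * (?r s + ?s)"
      by (simp add: mult_ac)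
    \<comment> \<open>The remaining factor is nonpositive, so a lower bound on the sum of the two
      densities is what is needed; each is at least \<open>rho_min\<close>, whence the 2 in the
      rate.\<close>
    also have "\<dots> \<le> vmax' * (?r s - ?s)\<^sup>2 * (gap x i s / \<eta>) * (2 * rho_min N J Lbar x)"
    proof (rule mult_left_mono_neg)
      show "2 * rho_min N J Lbar x \<le> ?r s + ?s" using rho_min_le[OF i, of s] s by simp
      show "vmax' * (?r s - ?s)\<^sup>2 * (gap x i s / \<eta>) \<le> 0"
        using g eta_pos vmax'_neg by (intro mult_nonpos_nonneg) auto
    qed
    also have "\<dots> = 2 / \<eta> * vmax' * rho_min N J Lbar x * l s"
      by (simp add: l_def mult_ac)
    finally show "?D s \<le> 2 / \<eta> * vmax' * rho_min N J Lbar x * l s" .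
  qed fact
  then show ?thesis by simp
qed

lemma lyapunov_decay:
  assumes "0 \<le> t"
  shows "lyapunov N J Lbar x t
    \<le> lyapunov N J Lbar x 0 * exp (2 / \<eta> * vmax' * rho_min N J Lbar x * t)"
  unfolding lyapunov_def sum_distrib_right
  using lyapunov_summand_decay assms by (intro sum_mono) auto

end

theorem theorem3p5:
  fixes \<eta> vbar vmax' :: real
    and w :: "real \<Rightarrow> real"
    and v :: "real \<Rightarrow> real \<Rightarrow> real"
    and rho_max :: "real \<Rightarrow> real"
    and N N\<eta> J :: nat
    and \<omega> Lbar :: "nat \<Rightarrow> real"
    and x :: "nat \<Rightarrow> real \<Rightarrow> real"
  assumes "1 \<le> N"
    and "\<And>i. i < N \<Longrightarrow> 0 < \<omega> i"
    and "0 < vbar"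
    and "vbar \<le> Min (\<omega> ` {..<N})"
    and "micro_model \<eta> w v rho_max N N\<eta> \<omega> vbar x"
    and "\<And>i. i < N \<Longrightarrow> equilibrium_distance v rho_max N vbar (\<omega> i) (Lbar i)"
    and "\<And>s. s \<in> {0..\<eta>} \<Longrightarrow> w s = 1 / \<eta>"
    and "vmax' < 0"
    and "\<And>i \<rho>. i < N \<Longrightarrow> \<rho> \<in> {0..rho_max (\<omega> i)} \<Longrightarrow> partial_rho v \<rho> (\<omega> i) \<le> vmax'"
    and "\<exists>k<N. (\<Sum>i = k..<N. max (gap x i 0) (Lbar i)) \<le> \<eta>"
    and "J = (LEAST k. k < N \<and> (\<Sum>i = k..<N. max (gap x i 0) (Lbar i)) \<le> \<eta>)"
  shows "\<forall>t\<ge>0. lyapunov N J Lbar x t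
           \<le> lyapunov N J Lbar x 0 * exp (2 / \<eta> * vmax' * rho_min N J Lbar x * t)"
proof -
  interpret micro_model \<eta> w v rho_max N N\<eta> \<omega> vbar x by fact
  have J: "J < N \<and> (\<Sum>i=J..<N. max (gap x i 0) (Lbar i)) \<le> \<eta>"
    unfolding assms(11) by (rule LeastI_ex) (use assms(10) in auto)
  interpret relaxation_model \<eta> w v rho_max N N\<eta> \<omega> vbar x Lbar vmax' J
  proof
    show "vbar \<le> \<omega> i" if "i < N" for i
      using that by (intro order_trans[OF assms(4)] Min_le) auto
  qed (use assms(1-3,6-9) J in auto)
  show ?thesis using lyapunov_decay by blast
qed

end
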